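(* Let $\{B_j\}_{j\in[d_1]\times\cdots\times[d_M]}$ be orthonormal with respect to the probability measure $\rho$ on $Y$ and let $w\ge0$ be any weight function satisfying $\|w^{-1}\|_{L^1(Y,\rho)}=1$. Assume the weight sequence $\omega$ satisfies $\omega_j\ge\|w^{1/2}B_j\|_{L^\infty(Y,\rho)}$ for all $j$, let $R\in\mathbb{N}$, and fix $c,r>0$ and $$ \tilde r:=(1+c^2)\,\|\omega^{-1}\|_{\ell^{2/3}}^2\,r . $$ Then it holds that $$ d_{\mathrm{si}L^\infty_w}\big(\tilde{\mathcal{M}}_{R,r,\omega},B_{\ell^0_\omega}(0,\tilde r)\big)\le\frac1c . $$ Hence, if $0<\delta\le\tfrac12$ and $c\ge\tfrac{15}{\delta}$, then $\operatorname{RIP}_{B_{\ell^0_\omega}(0,\tilde r)}(\delta)$ implies $\operatorname{RIP}_{\tilde{\mathcal{M}}_{R,r,\omega}}(2\delta)$.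
   Context: Notation: $[m]=\{1,\ldots,m\}$. A coefficient tensor $v\in\mathbb{R}^{d_1\times\cdots\times d_M}$ is identified with the function $\sum_jv_jB_j$ on $Y$ (and sets of tensors with sets of functions). Operations on weight sequences are element-wise. $\|v\|_{\ell^0_\omega}:=\sum_{j:\,v_j\ne0}\omega_j^2$ and $B_{\ell^0_\omega}(0,r):=\{v:\|v\|_{\ell^0_\omega}\le r\}$. Model class: for a weight tensor $\eta$ on $[d_1]\times\cdots\times[d_M]$ and $k\in[M]$, let $\tilde{\mathcal{Q}}_{k,R,\eta}$ be the set of linear operators $Q:\mathbb{R}^{r_{k-1}\times d_k\times r_k}\to\mathbb{R}^{d_1\times\cdots\times d_M}$, with some $r_{k-1},r_k\le R$, which, interpreted as matrices after vectorisation, satisfy $Q^\intercal Q=I$ and for which $Q^\intercal\operatorname{diag}(\eta^2)Q$ is diagonal. For such $Q$ define the weights $\beta_Q$ by $\beta_Q^2:=\operatorname{diag}\big(Q^\intercal\operatorname{diag}(\eta^2)Q\big)$ (the vector of diagonal entries) and $\mathcal{C}_{Q,r,\eta}:=\{C\in\mathbb{R}^{r_{k-1}\times d_k\times r_k}:\|C\|_{\ell^0_{\beta_Q}}\le r\}$. Then $$ \tilde{\mathcal{M}}_{R,r,\omega}:=\bigcap_{k\in[M]}\ \bigcup_{Q\in\tilde{\mathcal{Q}}_{k,R,\omega^3}}Q\,\mathcal{C}_{Q,r,\omega^3}. $$ Norms and RIP: $\|v\|:=\|v\|_{L^2(Y,\rho)}$, $\|v\|_{L^\infty_w}:=\|w^{1/2}v\|_{L^\infty(Y,\rho)}$,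 and for given sample points $y^1,\ldots,y^n\in Y$, $\|v\|_n:=\big(\tfrac1n\sum_{i=1}^nw(y^i)|v(y^i)|^2\big)^{1/2}$; point values are understood so that $w(y^i)^{1/2}|v(y^i)|\le\|v\|_{L^\infty_w}$. $\operatorname{RIP}_A(\delta)$ means $(1-\delta)\|u\|^2\le\|u\|_n^2\le(1+\delta)\|u\|^2$ for all $u\in A$. Distance: $d_{\mathrm{si}L^\infty_w}(A,B):=\sup_{a\in A,\,a\ne0}\ \inf\{\|ta-b\|_{L^\infty_w}:t>0,\ b\in U(B)\}$, where $U(B):=\{b/\|b\|:b\in B,\ b\ne0\}$. *)

theory Defs
  imports "HOL-Probability.Probability" "HOL-Probability.Essential_Supremum"
begin

section \<open>Tensors and weighted sequence norms\<close>

definition tensor_index :: "nat \<Rightarrow> (nat \<Rightarrow> nat) \<Rightarrow> (nat \<Rightarrow> nat) set" where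
  "tensor_index m d = (\<Pi>\<^sub>E k\<in>{1..m}. {1..d k})"

text \<open>
  A tensor with index set \<open>I\<close> is a function that vanishes off \<open>I\<close>, so that equality of
  tensors is equality of functions.
\<close>

definition tensors :: "'i set \<Rightarrow> ('i \<Rightarrow> real) set" where
  "tensors I = {v. \<forall>i. i \<notin> I \<longrightarrow> v i = 0}"

definition l0_weighted :: "'i set \<Rightarrow> ('i \<Rightarrow> real) \<Rightarrow> ('i \<Rightarrow> real) \<Rightarrow> real" where
  "l0_weighted I \<omega> v = (\<Sum>i\<in>{i\<in>I. v i \<noteq> 0}. (\<omega> i)\<^sup>2)"

definition l0_ball :: "'i set \<Rightarrow> ('i \<Rightarrow> real) \<Rightarrow> real \<Rightarrow> ('i \<Rightarrow> real) set" where
  "l0_ball I \<omega> r = {v \<in> tensors I. l0_weighted I \<omega> v \<le> r}"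

definition lp_norm :: "'i set \<Rightarrow> real \<Rightarrow> ('i \<Rightarrow> real) \<Rightarrow> real" where
  "lp_norm I p v = (\<Sum>i\<in>I. \<bar>v i\<bar> powr p) powr (1 / p)"

section \<open>The model class\<close>

text \<open>
  A linear operator from tensors over \<open>I\<close> to tensors over \<open>J\<close> is given by its matrix
  \<open>q\<close>, where \<open>q j i\<close> is the entry in row \<open>j \<in> J\<close> and column \<open>i \<in> I\<close>; entries
  off \<open>J \<times> I\<close> play no role.
\<close>

definition op_apply ::
  "'j set \<Rightarrow> 'i set \<Rightarrow> ('j \<Rightarrow> 'i \<Rightarrow> real) \<Rightarrow> ('i \<Rightarrow> real) \<Rightarrow> ('j \<Rightarrow> real)" where
  "op_apply J I q C = (\<lambda>j. if j \<in> J then \<Sum>i\<in>I. q j i * C i else 0)"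

text \<open>The \<open>(i, i')\<close> entry of \<open>Q\<^sup>T diag(\<eta>\<^sup>2) Q\<close>.\<close>

definition weighted_gram ::
  "'j set \<Rightarrow> ('j \<Rightarrow> real) \<Rightarrow> ('j \<Rightarrow> 'i \<Rightarrow> real) \<Rightarrow> 'i \<Rightarrow> 'i \<Rightarrow> real" where
  "weighted_gram J \<eta> q i i' = (\<Sum>j\<in>J. q j i * (\<eta> j)\<^sup>2 * q j i')"

definition core_weight ::
  "'j set \<Rightarrow> ('j \<Rightarrow> real) \<Rightarrow> ('j \<Rightarrow> 'i \<Rightarrow> real) \<Rightarrow> 'i \<Rightarrow> real" where
  "core_weight J \<eta> q i = sqrt (weighted_gram J \<eta> q i i)"

definition core_index :: "(nat \<Rightarrow> nat) \<Rightarrow> nat \<Rightarrow> nat \<Rightarrow> nat \<Rightarrow> (nat \<times> nat \<times> nat) set" where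
  "core_index d k a b = {1..a} \<times> {1..d k} \<times> {1..b}"

text \<open>An operator is listed together with the ranks \<open>a = r\<^sub>k\<^sub>-\<^sub>1\<close> and \<open>b = r\<^sub>k\<close> that fix its domain.\<close>

definition model_ops ::
  "nat \<Rightarrow> (nat \<Rightarrow> nat) \<Rightarrow> nat \<Rightarrow> nat \<Rightarrow> ((nat \<Rightarrow> nat) \<Rightarrow> real) \<Rightarrow>
    (nat \<times> nat \<times> ((nat \<Rightarrow> nat) \<Rightarrow> nat \<times> nat \<times> nat \<Rightarrow> real)) set" where
  "model_ops m d k R \<eta> =
    {(a, b, q). a \<in> {1..R} \<and> b \<in> {1..R} \<and>
      (\<forall>i\<in>core_index d k a b. \<forall>i'\<in>core_index d k a b.
        (\<Sum>j\<in>tensor_index m d. q j i * q j i') = (if i = i' then 1 else 0)) \<and>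
      (\<forall>i\<in>core_index d k a b. \<forall>i'\<in>core_index d k a b.
        i \<noteq> i' \<longrightarrow> weighted_gram (tensor_index m d) \<eta> q i i' = 0)}"

definition model_class ::
  "nat \<Rightarrow> (nat \<Rightarrow> nat) \<Rightarrow> nat \<Rightarrow> real \<Rightarrow> ((nat \<Rightarrow> nat) \<Rightarrow> real) \<Rightarrow> ((nat \<Rightarrow> nat) \<Rightarrow> real) set" where
  "model_class m d R r \<omega> =
    (\<Inter>k\<in>{1..m}. \<Union>(a, b, q)\<in>model_ops m d k R (\<lambda>j. \<omega> j ^ 3).
      op_apply (tensor_index m d) (core_index d k a b) q `
        l0_ball (core_index d k a b) (core_weight (tensor_index m d) (\<lambda>j. \<omega> j ^ 3) q) r)"

section \<open>Functions on the sample space\<close>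

definition orthonormal_family :: "'y measure \<Rightarrow> 'i set \<Rightarrow> ('i \<Rightarrow> 'y \<Rightarrow> real) \<Rightarrow> bool" where
  "orthonormal_family \<rho> J B \<longleftrightarrow>
    (\<forall>j\<in>J. B j \<in> borel_measurable \<rho> \<and> integrable \<rho> (\<lambda>x. (B j x)\<^sup>2)) \<and>
    (\<forall>i\<in>J. \<forall>j\<in>J. (\<integral>x. B i x * B j x \<partial>\<rho>) = (if i = j then 1 else 0))"

definition tensor_fun :: "'i set \<Rightarrow> ('i \<Rightarrow> 'y \<Rightarrow> real) \<Rightarrow> ('i \<Rightarrow> real) \<Rightarrow> 'y \<Rightarrow> real" where
  "tensor_fun J B v = (\<lambda>x. \<Sum>j\<in>J. v j * B j x)"

definition L2_nrm :: "'y measure \<Rightarrow> ('y \<Rightarrow> real) \<Rightarrow> real" where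
  "L2_nrm \<rho> f = sqrt (\<integral>x. (f x)\<^sup>2 \<partial>\<rho>)"

definition Linf_w :: "'y measure \<Rightarrow> ('y \<Rightarrow> real) \<Rightarrow> ('y \<Rightarrow> real) \<Rightarrow> ennreal" where
  "Linf_w \<rho> w f = esssup \<rho> (\<lambda>x. ennreal (sqrt (w x) * \<bar>f x\<bar>))"

definition empirical_nrm :: "('y \<Rightarrow> real) \<Rightarrow> nat \<Rightarrow> (nat \<Rightarrow> 'y) \<Rightarrow> ('y \<Rightarrow> real) \<Rightarrow> real" where
  "empirical_nrm w n y f = sqrt (1 / real n * (\<Sum>i\<in>{1..n}. w (y i) * \<bar>f (y i)\<bar>\<^sup>2))"

definition RIP ::
  "'y measure \<Rightarrow> ('y \<Rightarrow> real) \<Rightarrow> nat \<Rightarrow> (nat \<Rightarrow> 'y) \<Rightarrow> ('y \<Rightarrow> real) set \<Rightarrow> real \<Rightarrow> bool" where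
  "RIP \<rho> w n y A \<delta> \<longleftrightarrow>
    (\<forall>u\<in>A. (1 - \<delta>) * (L2_nrm \<rho> u)\<^sup>2 \<le> (empirical_nrm w n y u)\<^sup>2 \<and>
            (empirical_nrm w n y u)\<^sup>2 \<le> (1 + \<delta>) * (L2_nrm \<rho> u)\<^sup>2)"

text \<open>Functions are regarded up to null sets, so \<open>f \<noteq> 0\<close> means that \<open>f\<close> is not zero almost everywhere.\<close>

definition nonzero_in :: "'y measure \<Rightarrow> ('y \<Rightarrow> real) set \<Rightarrow> ('y \<Rightarrow> real) set" where
  "nonzero_in \<rho> A = {f \<in> A. \<not> (AE x in \<rho>. f x = 0)}"

definition normalised :: "'y measure \<Rightarrow> ('y \<Rightarrow> real) set \<Rightarrow> ('y \<Rightarrow> real) set" where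
  "normalised \<rho> B = (\<lambda>b x. b x / L2_nrm \<rho> b) ` nonzero_in \<rho> B"

definition dist_si_Linf_w ::
  "'y measure \<Rightarrow> ('y \<Rightarrow> real) \<Rightarrow> ('y \<Rightarrow> real) set \<Rightarrow> ('y \<Rightarrow> real) set \<Rightarrow> ennreal" where
  "dist_si_Linf_w \<rho> w A B =
    (SUP a\<in>nonzero_in \<rho> A.
      INF (t, b)\<in>{0<..} \<times> normalised \<rho> B. Linf_w \<rho> w (\<lambda>x. t * a x - b x))"

end

theory Submission
  imports Defs
begin

text \<open>
  The coefficients of a function in the model class decay in the weighted sense
  \<open>\<Sum>\<^sub>j \<omega>\<^sub>j\<^sup>6 v\<^sub>j\<^sup>2 \<le> r \<parallel>v\<parallel>\<^sup>2\<close>: if \<open>v = Q C\<close>, the two orthogonality conditions on \<open>Q\<close> turn the left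
  side into \<open>\<Sum>\<^sub>i \<beta>\<^sub>i\<^sup>2 C\<^sub>i\<^sup>2\<close> and \<open>\<parallel>v\<parallel>\<close> into \<open>\<parallel>C\<parallel>\<close>, and the weighted support size of \<open>C\<close> is at
  most \<open>r\<close> (\<open>model_class_energy\<close>).

  Such coefficients are well approximated by few of them. Hoelder's inequality gives
  \<open>P\<^sup>2 \<le> \<parallel>\<omega>\<^sup>-\<^sup>1\<parallel> \<parallel>\<omega>\<^sup>3 v\<parallel>\<close> for \<open>P = \<Sum>\<^sub>j \<omega>\<^sub>j |v\<^sub>j|\<^sup>1\<^sup>/\<^sup>2\<close>, where \<open>\<omega>\<^sup>-\<^sup>1\<close> is measured in \<open>\<ell>\<^sup>2\<^sup>/\<^sup>3\<close> and
  \<open>\<omega>\<^sup>3 v\<close> in \<open>\<ell>\<^sup>2\<close> (\<open>half_power_sum_le_energy\<close>). Keeping the entries above a suitable threshold then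
  yields a set of weight at most \<open>s\<close> whose complement has weighted \<open>\<ell>\<^sup>1\<close> norm at most
  \<open>P\<^sup>2 / \<surd>s\<close> (\<open>threshold_approximation\<close>). For \<open>s\<close> equal to the claimed radius the tail is at most
  \<open>\<parallel>v\<parallel> / \<surd>(1 + c\<^sup>2)\<close>; by Pythagoras the retained part has norm at least \<open>c\<close> times the tail, so after
  normalising the retained part the error is at most \<open>1 / c\<close> (\<open>near_normalised_sparse\<close>).

  The weighted \<open>\<ell>\<^sup>1\<close> norm of the coefficients dominates the weighted supremum norm of the function by
  the triangle inequality. It also dominates the \<open>L\<^sup>2\<close> norm, because the normalisation of
  \<open>w\<^sup>-\<^sup>1\<close> forces \<open>\<omega> \<ge> 1\<close> (\<open>one_le_weight\<close>). So the true and the empirical norms of a rescaled model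
  function both differ by at most \<open>1 / c \<le> \<delta> / 15\<close> from those of a normalised sparse function, and a
  numerical estimate (\<open>perturbed_isometry_bounds\<close>) gives the isometry with \<open>2\<delta>\<close>.
\<close>

section \<open>Operators with diagonal Gram matrix\<close>

text \<open>
  Expanding the square gives the quadratic form of \<open>Q\<^sup>T diag(\<theta>) Q\<close>. It is used with
  \<open>\<theta> = 1\<close>, where it says that \<open>Q\<close> is an isometry, and with \<open>\<theta> = \<eta>\<^sup>2\<close>.
\<close>

lemma sum_square_op_apply:
  assumes "finite I"
    and gram: "\<And>i i'. i \<in> I \<Longrightarrow> i' \<in> I \<Longrightarrow>
      (\<Sum>j\<in>J. q j i * \<theta> j * q j i') = (if i = i' then g i else 0)"
  shows "(\<Sum>j\<in>J. \<theta> j * (op_apply J I q C j)\<^sup>2) = (\<Sum>i\<in>I. g i * (C i)\<^sup>2)"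
proof -
  have "(\<Sum>j\<in>J. \<theta> j * (op_apply J I q C j)\<^sup>2)
      = (\<Sum>j\<in>J. \<Sum>i\<in>I. \<Sum>i'\<in>I. C i * C i' * (q j i * \<theta> j * q j i'))"
    by (intro sum.cong refl)
       (simp add: op_apply_def power2_eq_square sum_product sum_distrib_left mult_ac)
  also have "\<dots> = (\<Sum>i\<in>I. \<Sum>j\<in>J. \<Sum>i'\<in>I. C i * C i' * (q j i * \<theta> j * q j i'))"
    by (rule sum.swap)
  also have "\<dots> = (\<Sum>i\<in>I. \<Sum>i'\<in>I. \<Sum>j\<in>J. C i * C i' * (q j i * \<theta> j * q j i'))"
    by (intro sum.cong refl sum.swap)
  also have "\<dots> = (\<Sum>i\<in>I. \<Sum>i'\<in>I. C i * C i' * (if i = i' then g i else 0))"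
    by (intro sum.cong refl) (simp add: gram flip: sum_distrib_left)
  also have "\<dots> = (\<Sum>i\<in>I. \<Sum>i'\<in>I. if i = i' then g i * (C i)\<^sup>2 else 0)"
    by (intro sum.cong refl) (simp add: power2_eq_square)
  also have "\<dots> = (\<Sum>i\<in>I. g i * (C i)\<^sup>2)"
    using \<open>finite I\<close> by simp
  finally show ?thesis .
qed

text \<open>
  The model class enters the proof only through this decay of its coefficients.
\<close>

lemma model_class_energy:
  assumes v: "v \<in> model_class m d R r \<omega>" and "m \<ge> 1"
  shows "v \<in> tensors (tensor_index m d)"
    and "(\<Sum>j\<in>tensor_index m d. (\<omega> j ^ 3 * v j)\<^sup>2) \<le> r * (\<Sum>j\<in>tensor_index m d. (v j)\<^sup>2)"
proof -
  define J where "J = tensor_index m d"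
  define \<eta> where "\<eta> = (\<lambda>j. \<omega> j ^ 3)"
  have "1 \<in> {1..m}" using assms(2) by simp
  with v obtain a b q where op: "(a, b, q) \<in> model_ops m d 1 R \<eta>"
    and "v \<in> op_apply J (core_index d 1 a b) q `
        l0_ball (core_index d 1 a b) (core_weight J \<eta> q) r"
    unfolding model_class_def J_def \<eta>_def by fastforce
  then obtain C where C: "C \<in> l0_ball (core_index d 1 a b) (core_weight J \<eta> q) r"
    and vC: "v = op_apply J (core_index d 1 a b) q C" by auto
  define I where "I = core_index d 1 a b"
  define g where "g i = weighted_gram J \<eta> q i i" for i
  have finI: "finite I" by (simp add: I_def core_index_def)
  have g0: "g i \<ge> 0" for i
    unfolding g_def weighted_gram_def
    by (intro sum_nonneg) (simp add: mult.commute flip: mult.assoc power2_eq_square)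
  have e1: "(\<Sum>j\<in>J. (v j)\<^sup>2) = (\<Sum>i\<in>I. (C i)\<^sup>2)"
    using sum_square_op_apply[OF finI, where J = J and q = q and \<theta> = "\<lambda>_. 1" and g = "\<lambda>_. 1" and C = C] op
    by (simp add: vC model_ops_def I_def J_def)
  have "(\<Sum>j\<in>J. (\<eta> j * v j)\<^sup>2) = (\<Sum>j\<in>J. (\<eta> j)\<^sup>2 * (v j)\<^sup>2)"
    by (simp add: power_mult_distrib)
  also have "\<dots> = (\<Sum>i\<in>I. g i * (C i)\<^sup>2)"
    unfolding vC I_def[symmetric]
  proof (rule sum_square_op_apply[OF finI])
    fix i i' assume "i \<in> I" "i' \<in> I"
    then show "(\<Sum>j\<in>J. q j i * (\<eta> j)\<^sup>2 * q j i') = (if i = i' then g i else 0)"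
      using op by (auto simp: model_ops_def I_def J_def g_def weighted_gram_def)
  qed
  also have "\<dots> = (\<Sum>i\<in>{i\<in>I. C i \<noteq> 0}. g i * (C i)\<^sup>2)"
    by (rule sum.mono_neutral_right) (use finI in auto)
  \<comment> \<open>a crude bound on each entry suffices: \<open>|C\<^sub>i|\<close> is at most the Euclidean norm of \<open>C\<close>\<close>
  also have "\<dots> \<le> (\<Sum>i\<in>{i\<in>I. C i \<noteq> 0}. g i * (\<Sum>i\<in>I. (C i)\<^sup>2))"
    by (intro sum_mono mult_left_mono member_le_sum) (use finI g0 in auto)
  also have "\<dots> = l0_weighted I (core_weight J \<eta> q) C * (\<Sum>i\<in>I. (C i)\<^sup>2)"
    by (simp add: l0_weighted_def core_weight_def g0 flip: sum_distrib_right g_def)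
  also have "\<dots> \<le> r * (\<Sum>i\<in>I. (C i)\<^sup>2)"
    using C by (intro mult_right_mono sum_nonneg) (auto simp: l0_ball_def I_def)
  finally show "(\<Sum>j\<in>tensor_index m d. (\<omega> j ^ 3 * v j)\<^sup>2)
      \<le> r * (\<Sum>j\<in>tensor_index m d. (v j)\<^sup>2)"
    using e1 by (simp add: \<eta>_def J_def)
  show "v \<in> tensors (tensor_index m d)"
    by (simp add: vC tensors_def op_apply_def J_def)
qed

section \<open>Sparse approximation by thresholding\<close>

lemma L2_set_le_weighted_l1:
  assumes "\<And>j. j \<in> J \<Longrightarrow> \<omega> j \<ge> 1"
  shows "L2_set v J \<le> (\<Sum>j\<in>J. \<omega> j * \<bar>v j\<bar>)"
proof -
  have "\<bar>v j\<bar> \<le> \<omega> j * \<bar>v j\<bar>" if "j \<in> J" for j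
    using mult_right_mono[OF assms[OF that], of "\<bar>v j\<bar>"] by simp
  then show ?thesis
    by (intro order_trans[OF L2_set_le_sum_abs] sum_mono)
qed

text \<open>
  A Hoelder inequality with exponents \<open>4/3\<close> and \<open>4\<close>, written with the weights \<open>x\<close> as a measure; in this
  form it is the Cauchy-Schwarz inequality applied twice, first to \<open>g\<close> and then to \<open>g\<^sup>2\<close>.
\<close>

lemma sum_mult_power4_le:
  fixes x g :: "'i \<Rightarrow> real"
  assumes x: "\<And>i. i \<in> I \<Longrightarrow> x i \<ge> 0"
  shows "(\<Sum>i\<in>I. x i * g i) ^ 4 \<le> (\<Sum>i\<in>I. x i) ^ 3 * (\<Sum>i\<in>I. x i * g i ^ 4)"
proof -
  have sq: "(\<Sum>i\<in>I. x i * h i)\<^sup>2 \<le> (\<Sum>i\<in>I. x i) * (\<Sum>i\<in>I. x i * (h i)\<^sup>2)" for h :: "'i \<Rightarrow> real"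
  proof -
    have "(\<Sum>i\<in>I. x i * h i) = (\<Sum>i\<in>I. sqrt (x i) * (sqrt (x i) * h i))"
      using x by (intro sum.cong refl) (simp flip: mult.assoc)
    moreover have "(\<Sum>i\<in>I. (sqrt (x i))\<^sup>2) = (\<Sum>i\<in>I. x i)"
      using x by (intro sum.cong refl) simp
    moreover have "(\<Sum>i\<in>I. (sqrt (x i) * h i)\<^sup>2) = (\<Sum>i\<in>I. x i * (h i)\<^sup>2)"
      using x by (intro sum.cong refl) (simp add: power_mult_distrib)
    ultimately show ?thesis
      using Cauchy_Schwarz_ineq_sum[of "\<lambda>i. sqrt (x i)" "\<lambda>i. sqrt (x i) * h i" I] by simp
  qed
  have X: "(\<Sum>i\<in>I. x i) \<ge> 0" by (rule sum_nonneg) (rule x)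
  have "(\<Sum>i\<in>I. x i * g i) ^ 4 = ((\<Sum>i\<in>I. x i * g i)\<^sup>2)\<^sup>2" by simp
  also have "\<dots> \<le> ((\<Sum>i\<in>I. x i) * (\<Sum>i\<in>I. x i * (g i)\<^sup>2))\<^sup>2"
    by (intro power_mono sq) simp
  also have "\<dots> = (\<Sum>i\<in>I. x i)\<^sup>2 * (\<Sum>i\<in>I. x i * (g i)\<^sup>2)\<^sup>2"
    by (simp add: power_mult_distrib)
  also have "\<dots> \<le> (\<Sum>i\<in>I. x i)\<^sup>2 * ((\<Sum>i\<in>I. x i) * (\<Sum>i\<in>I. x i * ((g i)\<^sup>2)\<^sup>2))"
    by (intro mult_left_mono sq) simp
  finally show ?thesis by (simp add: power3_eq_cube power2_eq_square[of "sum x I"] mult_ac)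
qed

text \<open>
  The exponents in \<open>\<omega> |v|\<^sup>1\<^sup>/\<^sup>2 = \<omega>\<^sup>-\<^sup>2\<^sup>/\<^sup>3 \<cdot> (\<omega>\<^sup>5\<^sup>/\<^sup>3 |v|\<^sup>1\<^sup>/\<^sup>2)\<close> are chosen so that the fourth power of the
  second factor, weighted by the first, is \<open>(\<omega>\<^sup>3 v)\<^sup>2\<close>.
\<close>

lemma half_power_sum_le_energy:
  fixes \<omega> v :: "'i \<Rightarrow> real"
  assumes \<omega>: "\<And>j. j \<in> J \<Longrightarrow> \<omega> j > 0"
  shows "(\<Sum>j\<in>J. \<omega> j * sqrt \<bar>v j\<bar>) ^ 4
    \<le> (lp_norm J (2/3) (\<lambda>j. inverse (\<omega> j)))\<^sup>2 * (\<Sum>j\<in>J. (\<omega> j ^ 3 * v j)\<^sup>2)"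
proof -
  define x where "x j = \<omega> j powr (-2/3)" for j
  define g where "g j = \<omega> j powr (5/3) * sqrt \<bar>v j\<bar>" for j
  have x0: "x j \<ge> 0" for j by (simp add: x_def)
  have "(\<Sum>j\<in>J. \<omega> j * sqrt \<bar>v j\<bar>) = (\<Sum>j\<in>J. x j * g j)"
  proof (intro sum.cong refl)
    fix j assume "j \<in> J"
    then have "\<omega> j powr (-2/3) * \<omega> j powr (5/3) = \<omega> j"
      using \<omega>[of j] by (simp flip: powr_add)
    then show "\<omega> j * sqrt \<bar>v j\<bar> = x j * g j"
      by (simp add: x_def g_def flip: mult.assoc)
  qed
  moreover have "(\<Sum>j\<in>J. x j * g j ^ 4) = (\<Sum>j\<in>J. (\<omega> j ^ 3 * v j)\<^sup>2)"
  proof (intro sum.cong refl)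
    fix j assume j: "j \<in> J"
    have "(\<omega> j powr (5/3)) ^ 4 = \<omega> j powr (20/3)"
      using \<omega>[OF j] by (simp add: powr_powr flip: powr_realpow)
    then have "\<omega> j powr (-2/3) * (\<omega> j powr (5/3)) ^ 4 = \<omega> j powr 6"
      by (simp flip: powr_add)
    also have "\<dots> = \<omega> j ^ 6" using powr_realpow[OF \<omega>[OF j], of 6] by simp
    finally have 1: "\<omega> j powr (-2/3) * (\<omega> j powr (5/3)) ^ 4 = \<omega> j ^ 6" .
    have 2: "sqrt \<bar>v j\<bar> ^ 4 = (v j)\<^sup>2"
      using power_mult[of "sqrt \<bar>v j\<bar>" 2 2] by simp
    show "x j * g j ^ 4 = (\<omega> j ^ 3 * v j)\<^sup>2"
      using 1 2 by (simp add: x_def g_def power_mult_distrib flip: mult.assoc power_mult)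
  qed
  moreover have "(lp_norm J (2/3) (\<lambda>j. inverse (\<omega> j)))\<^sup>2 = (\<Sum>j\<in>J. x j) ^ 3"
  proof -
    have "(\<Sum>j\<in>J. \<bar>inverse (\<omega> j)\<bar> powr (2/3)) = (\<Sum>j\<in>J. x j)"
    proof (intro sum.cong refl)
      fix j assume "j \<in> J"
      from \<omega>[OF this] show "\<bar>inverse (\<omega> j)\<bar> powr (2/3) = x j"
        by (simp add: x_def powr_minus inverse_powr)
    qed
    then have "(lp_norm J (2/3) (\<lambda>j. inverse (\<omega> j)))\<^sup>2 = ((\<Sum>j\<in>J. x j) powr (3/2))\<^sup>2"
      by (simp add: lp_norm_def)
    also have "\<dots> = (\<Sum>j\<in>J. x j) ^ 3"
    proof (cases "(\<Sum>j\<in>J. x j) = 0")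
      case False
      with x0 have "(\<Sum>j\<in>J. x j) > 0" by (simp add: order.not_eq_order_implies_strict sum_nonneg)
      then have "(\<Sum>j\<in>J. x j) powr 3 = (\<Sum>j\<in>J. x j) ^ 3" by simp
      then show ?thesis by (simp add: power2_eq_square flip: powr_add)
    qed simp
    finally show ?thesis .
  qed
  ultimately show ?thesis
    using sum_mult_power4_le[of J x g] x0 by simp
qed

text \<open>
  A Stechkin estimate that does not need the entries to be sorted. If \<open>S\<close> collects the \<open>j\<close> with
  \<open>|v\<^sub>j|\<^sup>1\<^sup>/\<^sup>2 \<ge> \<tau>\<close>, then \<open>\<tau> \<Sum>\<^sub>S \<omega> \<le> P\<close>, while off \<open>S\<close> one factor \<open>|v\<^sub>j|\<^sup>1\<^sup>/\<^sup>2\<close> of \<open>|v\<^sub>j|\<close> is below \<open>\<tau>\<close>. The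
  weight \<open>\<Sum>\<^sub>S \<omega>\<^sup>2\<close> is controlled through \<open>\<Sum>\<^sub>S \<omega>\<^sup>2 \<le> (\<Sum>\<^sub>S \<omega>)\<^sup>2\<close>.
\<close>

lemma threshold_approximation:
  fixes \<omega> v :: "'i \<Rightarrow> real"
  assumes fin: "finite J" and \<omega>: "\<And>j. j \<in> J \<Longrightarrow> \<omega> j > 0"
    and v: "\<exists>j\<in>J. v j \<noteq> 0" and s: "s > 0"
  defines "P \<equiv> (\<Sum>j\<in>J. \<omega> j * sqrt \<bar>v j\<bar>)"
  obtains S where "S \<subseteq> J" "(\<Sum>j\<in>S. (\<omega> j)\<^sup>2) \<le> s"
    "(\<Sum>j\<in>J - S. \<omega> j * \<bar>v j\<bar>) \<le> P\<^sup>2 / sqrt s"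
proof -
  have P: "P > 0"
  proof -
    obtain j where "j \<in> J" "v j \<noteq> 0" using v by blast
    then show ?thesis unfolding P_def
      by (intro sum_pos2[OF fin, of j]) (auto simp: \<omega> less_imp_le)
  qed
  \<comment> \<open>the square root of the threshold; it is chosen to make the weight bound equal to \<open>s\<close>\<close>
  define \<tau> where "\<tau> = P / sqrt s"
  have \<tau>: "\<tau> > 0" using P s by (simp add: \<tau>_def)
  define S where "S = {j\<in>J. sqrt \<bar>v j\<bar> \<ge> \<tau>}"
  have SJ: "S \<subseteq> J" by (auto simp: S_def)
  then have finS: "finite S" using fin finite_subset by blast
  have w0: "0 \<le> \<omega> j" if "j \<in> J" for j using \<omega>[OF that] by simp
  have "\<tau> * (\<Sum>j\<in>S. \<omega> j) \<le> (\<Sum>j\<in>S. \<omega> j * sqrt \<bar>v j\<bar>)"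
    unfolding sum_distrib_left
    by (intro sum_mono) (auto simp: S_def w0 mult.commute[of \<tau>] intro!: mult_left_mono)
  also have "\<dots> \<le> P"
    unfolding P_def by (rule sum_mono2[OF fin SJ]) (simp add: w0)
  finally have "(\<Sum>j\<in>S. \<omega> j) \<le> P / \<tau>" using \<tau> by (simp add: field_simps)
  also have "P / \<tau> = sqrt s" using P by (simp add: \<tau>_def)
  finally have sum_le: "(\<Sum>j\<in>S. \<omega> j) \<le> sqrt s" .
  have "L2_set \<omega> S \<le> (\<Sum>j\<in>S. \<omega> j)"
    using SJ by (intro L2_set_le_sum) (auto intro: w0)
  with sum_le have "L2_set \<omega> S \<le> sqrt s" by simp
  then have 1: "(\<Sum>j\<in>S. (\<omega> j)\<^sup>2) \<le> s" by (simp add: L2_set_def)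
  have "(\<Sum>j\<in>J - S. \<omega> j * \<bar>v j\<bar>) \<le> (\<Sum>j\<in>J - S. \<tau> * (\<omega> j * sqrt \<bar>v j\<bar>))"
  proof (rule sum_mono)
    fix j assume j: "j \<in> J - S"
    have "\<bar>v j\<bar> = sqrt \<bar>v j\<bar> * sqrt \<bar>v j\<bar>" by simp
    also have "\<dots> \<le> \<tau> * sqrt \<bar>v j\<bar>"
      using j by (intro mult_right_mono) (auto simp: S_def)
    finally have "\<omega> j * \<bar>v j\<bar> \<le> \<omega> j * (\<tau> * sqrt \<bar>v j\<bar>)"
      using j w0 by (intro mult_left_mono) auto
    then show "\<omega> j * \<bar>v j\<bar> \<le> \<tau> * (\<omega> j * sqrt \<bar>v j\<bar>)" by (simp add: mult_ac)
  qed
  also have "\<dots> \<le> \<tau> * P"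
    unfolding P_def sum_distrib_left[symmetric]
    using \<tau> fin w0 by (intro mult_left_mono sum_mono2) auto
  also have "\<dots> = P\<^sup>2 / sqrt s" by (simp add: \<tau>_def power2_eq_square)
  finally show thesis using that SJ 1 by blast
qed

text \<open>
  The scale \<open>t\<close> is the reciprocal of the norm of the retained part of \<open>v\<close>, so that \<open>b\<close> is that part
  normalised and \<open>t v - b\<close> is a multiple of the tail.
\<close>

lemma near_normalised_sparse:
  fixes \<omega> v :: "'i \<Rightarrow> real"
  assumes fin: "finite J" and \<omega>: "\<And>j. j \<in> J \<Longrightarrow> \<omega> j \<ge> 1"
    and v: "\<exists>j\<in>J. v j \<noteq> 0"
    and energy: "(\<Sum>j\<in>J. (\<omega> j ^ 3 * v j)\<^sup>2) \<le> r * (\<Sum>j\<in>J. (v j)\<^sup>2)"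
    and c: "c > 0" and r: "r > 0"
  defines "s \<equiv> (1 + c\<^sup>2) * (lp_norm J (2/3) (\<lambda>j. inverse (\<omega> j)))\<^sup>2 * r"
  obtains t b where "t > 0" "b \<in> l0_ball J \<omega> s" "L2_set b J = 1"
    "(\<Sum>j\<in>J. \<omega> j * \<bar>t * v j - b j\<bar>) \<le> 1 / c"
proof -
  define N where "N = (lp_norm J (2/3) (\<lambda>j. inverse (\<omega> j)))\<^sup>2"
  define E where "E = (\<Sum>j\<in>J. (v j)\<^sup>2)"
  define P where "P = (\<Sum>j\<in>J. \<omega> j * sqrt \<bar>v j\<bar>)"
  have \<omega>0: "\<omega> j > 0" if "j \<in> J" for j using \<omega>[OF that] by simp
  obtain j0 where j0: "j0 \<in> J" "v j0 \<noteq> 0" using v by blast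
  have E: "E > 0" unfolding E_def
    by (intro sum_pos2[OF fin j0(1)]) (use j0 in auto)
  have "P > 0" unfolding P_def
    by (intro sum_pos2[OF fin j0(1)]) (use j0 \<omega>0 in \<open>auto simp: less_imp_le\<close>)
  have "P ^ 4 \<le> N * (\<Sum>j\<in>J. (\<omega> j ^ 3 * v j)\<^sup>2)"
    unfolding P_def N_def by (rule half_power_sum_le_energy[OF \<omega>0])
  also have "\<dots> \<le> N * (r * E)"
    unfolding E_def by (intro mult_left_mono energy) (simp add: N_def)
  finally have PN: "P ^ 4 \<le> N * r * E" by (simp add: mult_ac)
  have Npos: "N > 0"
  proof -
    have "N * r * E > 0" using PN \<open>P > 0\<close> by (meson less_le_trans zero_less_power)
    then show ?thesis using r E by (simp add: zero_less_mult_iff)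
  qed
  have c2: "1 + c\<^sup>2 > 0" by (simp add: add_pos_nonneg)
  have s: "s = (1 + c\<^sup>2) * N * r" by (simp add: s_def N_def)
  then have spos: "s > 0" using c2 Npos r by simp
  obtain S where S: "S \<subseteq> J" "(\<Sum>j\<in>S. (\<omega> j)\<^sup>2) \<le> s"
    and tail: "(\<Sum>j\<in>J - S. \<omega> j * \<bar>v j\<bar>) \<le> P\<^sup>2 / sqrt s"
    unfolding P_def by (rule threshold_approximation[OF fin \<omega>0 v spos])
  define T where "T = (\<Sum>j\<in>J - S. \<omega> j * \<bar>v j\<bar>)"
  have T0: "T \<ge> 0" unfolding T_def by (intro sum_nonneg) (auto simp: \<omega>0 less_imp_le)
  have "T\<^sup>2 \<le> (P\<^sup>2 / sqrt s)\<^sup>2" using tail T0 by (intro power_mono) (simp_all add: T_def)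
  also have "\<dots> = P ^ 4 / s" using spos by (simp add: power_divide)
  also have "\<dots> \<le> N * r * E / s" using PN spos by (simp add: divide_right_mono)
  also have "\<dots> = E / (1 + c\<^sup>2)" using s Npos r by simp
  finally have T2: "T\<^sup>2 * (1 + c\<^sup>2) \<le> E" using c2 by (simp add: field_simps)
  have "L2_set v (J - S) \<le> T"
    unfolding T_def by (rule L2_set_le_weighted_l1) (use \<omega> in auto)
  then have "(\<Sum>j\<in>J - S. (v j)\<^sup>2) \<le> T\<^sup>2"
    unfolding L2_set_def using T0 by (simp add: real_le_lsqrt sqrt_le_D)
  moreover have "E = (\<Sum>j\<in>J - S. (v j)\<^sup>2) + (\<Sum>j\<in>S. (v j)\<^sup>2)"
    unfolding E_def using fin S(1) by (simp add: sum.subset_diff)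
  moreover define K where "K = L2_set v S"
  have K2: "K\<^sup>2 = (\<Sum>j\<in>S. (v j)\<^sup>2)" by (simp add: K_def L2_set_def sum_nonneg)
  \<comment> \<open>Pythagoras: removing the tail leaves enough mass for the relative error \<open>1 / c\<close>\<close>
  ultimately have KT: "(c * T)\<^sup>2 \<le> K\<^sup>2" and "K\<^sup>2 \<ge> E - T\<^sup>2"
    using T2 by (simp_all add: algebra_simps power_mult_distrib)
  have "K \<ge> 0" by (simp add: K_def)
  have "K\<^sup>2 > 0"
  proof (cases "T = 0")
    case True
    then have "E \<le> K\<^sup>2" using \<open>K\<^sup>2 \<ge> E - T\<^sup>2\<close> by simp
    with E show ?thesis by (rule less_le_trans)
  next
    case False
    then have "(c * T)\<^sup>2 > 0" using c by simp
    from this KT show ?thesis by (rule less_le_trans)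
  qed
  then have K: "K > 0" using \<open>K \<ge> 0\<close> by (cases "K = 0") auto
  have cT: "c * T \<le> K" using KT \<open>K \<ge> 0\<close> by (rule power2_le_imp_le)
  define b where "b j = (if j \<in> S then v j / K else 0)" for j
  have "l0_weighted J \<omega> b \<le> (\<Sum>j\<in>S. (\<omega> j)\<^sup>2)"
    unfolding l0_weighted_def using fin S(1)
    by (intro sum_mono2) (auto simp: b_def intro: finite_subset)
  then have b1: "b \<in> l0_ball J \<omega> s"
    using S by (auto simp: l0_ball_def tensors_def b_def)
  have "(\<Sum>j\<in>J. (b j)\<^sup>2) = (\<Sum>j\<in>S. (b j)\<^sup>2)"
    by (rule sum.mono_neutral_right) (use fin S in \<open>auto simp: b_def\<close>)
  also have "\<dots> = (\<Sum>j\<in>S. (v j)\<^sup>2) / K\<^sup>2"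
    by (simp add: b_def power_divide sum_divide_distrib)
  also have "\<dots> = 1" using K by (simp flip: K2)
  finally have b2: "L2_set b J = 1" by (simp add: L2_set_def)
  have "(\<Sum>j\<in>J. \<omega> j * \<bar>1 / K * v j - b j\<bar>) = (\<Sum>j\<in>J - S. \<omega> j * \<bar>1 / K * v j - b j\<bar>)"
    by (rule sum.mono_neutral_right) (use fin S in \<open>auto simp: b_def\<close>)
  also have "\<dots> = T / K"
    using K by (simp add: b_def T_def sum_divide_distrib)
  also have "\<dots> \<le> 1 / c" using cT K c by (simp add: field_simps)
  finally show thesis using that[of "1 / K" b] K b1 b2 by simp
qed

section \<open>Norms of finite expansions\<close>

lemma L2_nrm_tensor_fun:
  assumes fin: "finite J" and on: "orthonormal_family \<rho> J B"
  shows "L2_nrm \<rho> (tensor_fun J B v) = L2_set v J"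
proof -
  have int: "integrable \<rho> (\<lambda>x. B i x * B j x)" if "i \<in> J" "j \<in> J" for i j
  proof (rule Bochner_Integration.integrable_bound)
    show "integrable \<rho> (\<lambda>x. (B i x)\<^sup>2 + (B j x)\<^sup>2)"
      using on that by (auto simp: orthonormal_family_def)
    have "B i \<in> borel_measurable \<rho>" "B j \<in> borel_measurable \<rho>"
      using on that by (auto simp: orthonormal_family_def)
    then show "(\<lambda>x. B i x * B j x) \<in> borel_measurable \<rho>" by simp
    have "\<bar>a * b\<bar> \<le> a\<^sup>2 + b\<^sup>2" for a b :: real
    proof -
      have "2 * (\<bar>a\<bar> * \<bar>b\<bar>) \<le> a\<^sup>2 + b\<^sup>2"
        using sum_squares_bound[of "\<bar>a\<bar>" "\<bar>b\<bar>"] by simp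
      moreover have "0 \<le> \<bar>a\<bar> * \<bar>b\<bar>" by simp
      ultimately show ?thesis unfolding abs_mult by linarith
    qed
    then show "AE x in \<rho>. norm (B i x * B j x) \<le> norm ((B i x)\<^sup>2 + (B j x)\<^sup>2)"
      by simp
  qed
  have "(\<integral>x. (tensor_fun J B v x)\<^sup>2 \<partial>\<rho>)
      = (\<integral>x. (\<Sum>i\<in>J. \<Sum>j\<in>J. v i * v j * (B i x * B j x)) \<partial>\<rho>)"
    by (simp add: tensor_fun_def power2_eq_square sum_product mult_ac)
  also have "\<dots> = (\<Sum>i\<in>J. \<Sum>j\<in>J. v i * v j * (\<integral>x. B i x * B j x \<partial>\<rho>))"
    using int by (subst Bochner_Integration.integral_sum; auto intro!: sum.cong
        Bochner_Integration.integrable_sum simp: Bochner_Integration.integral_sum)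
  also have "\<dots> = (\<Sum>i\<in>J. \<Sum>j\<in>J. if i = j then v i * v j else 0)"
    using on by (intro sum.cong refl) (simp add: orthonormal_family_def)
  also have "\<dots> = (\<Sum>i\<in>J. (v i)\<^sup>2)"
    using fin by (simp add: power2_eq_square)
  finally show ?thesis by (simp add: L2_nrm_def L2_set_def)
qed

text \<open>
  The triangle inequality, carried out almost everywhere: outside one null set all of the finitely
  many \<open>B\<^sub>j\<close> obey their bounds.
\<close>

lemma Linf_w_tensor_fun_le:
  assumes fin: "finite J" and B: "\<And>j. j \<in> J \<Longrightarrow> B j \<in> borel_measurable \<rho>"
    and w: "w \<in> borel_measurable \<rho>" and w0: "\<And>x. x \<in> space \<rho> \<Longrightarrow> w x \<ge> 0"
    and bd: "\<And>j. j \<in> J \<Longrightarrow> Linf_w \<rho> w (B j) \<le> ennreal (\<omega> j)"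
    and \<omega>: "\<And>j. j \<in> J \<Longrightarrow> \<omega> j \<ge> 0"
  shows "Linf_w \<rho> w (tensor_fun J B u) \<le> ennreal (\<Sum>j\<in>J. \<omega> j * \<bar>u j\<bar>)"
  unfolding Linf_w_def
proof (rule esssup_I)
  have [measurable]: "tensor_fun J B u \<in> borel_measurable \<rho>"
    unfolding tensor_fun_def using B by (intro borel_measurable_sum) auto
  note w[measurable]
  show "(\<lambda>x. ennreal (sqrt (w x) * \<bar>tensor_fun J B u x\<bar>)) \<in> borel_measurable \<rho>"
    by measurable
  have "AE x in \<rho>. \<forall>j\<in>J. sqrt (w x) * \<bar>B j x\<bar> \<le> \<omega> j"
  proof (intro AE_finite_allI[OF fin])
    fix j assume j: "j \<in> J"
    have "AE x in \<rho>. ennreal (sqrt (w x) * \<bar>B j x\<bar>) \<le> Linf_w \<rho> w (B j)"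
      unfolding Linf_w_def by (rule esssup_AE)
    then show "AE x in \<rho>. sqrt (w x) * \<bar>B j x\<bar> \<le> \<omega> j"
    proof eventually_elim
      case (elim x)
      also note bd[OF j]
      finally show ?case using \<omega>[OF j] by simp
    qed
  qed
  with AE_space show "AE x in \<rho>. ennreal (sqrt (w x) * \<bar>tensor_fun J B u x\<bar>)
      \<le> ennreal (\<Sum>j\<in>J. \<omega> j * \<bar>u j\<bar>)"
  proof eventually_elim
    case (elim x)
    have "sqrt (w x) * \<bar>tensor_fun J B u x\<bar> \<le> sqrt (w x) * (\<Sum>j\<in>J. \<bar>u j * B j x\<bar>)"
      unfolding tensor_fun_def by (intro mult_left_mono sum_abs) (simp add: w0 elim)
    also have "\<dots> = (\<Sum>j\<in>J. (sqrt (w x) * \<bar>B j x\<bar>) * \<bar>u j\<bar>)"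
      by (simp add: sum_distrib_left abs_mult mult_ac)
    also have "\<dots> \<le> (\<Sum>j\<in>J. \<omega> j * \<bar>u j\<bar>)"
      using elim by (intro sum_mono mult_right_mono) auto
    finally show ?case by (rule ennreal_leI)
  qed
qed

text \<open>
  Off a null set \<open>w > 0\<close> and \<open>b\<^sup>2 = (w b\<^sup>2) / w \<le> \<omega>\<^sup>2 / w\<close>; integrating gives \<open>1 \<le> \<omega>\<^sup>2\<close>.
\<close>

lemma one_le_weight:
  assumes b: "b \<in> borel_measurable \<rho>" and b1: "(\<integral>x. b x * b x \<partial>\<rho>) = 1"
    and w: "w \<in> borel_measurable \<rho>" and w0: "\<And>x. x \<in> space \<rho> \<Longrightarrow> w x \<ge> 0"
    and winv: "(\<integral>\<^sup>+ x. inverse (ennreal (w x)) \<partial>\<rho>) = 1"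
    and bd: "Linf_w \<rho> w b \<le> ennreal \<omega>"
  shows "\<omega> \<ge> 1"
proof -
  note [measurable] = b w
  \<comment> \<open>\<open>ennreal\<close> sends negative reals to zero, so the sign of \<open>\<omega>\<close> has to be secured first\<close>
  define \<omega>' where "\<omega>' = max \<omega> 0"
  have bd': "Linf_w \<rho> w b \<le> ennreal \<omega>'"
    using bd by (rule order_trans) (simp add: \<omega>'_def ennreal_leI)
  have AE1: "AE x in \<rho>. ennreal (sqrt (w x) * \<bar>b x\<bar>) \<le> Linf_w \<rho> w b"
    unfolding Linf_w_def by (rule esssup_AE)
  have AE2: "AE x in \<rho>. inverse (ennreal (w x)) \<noteq> \<infinity>"
    using winv by (intro nn_integral_PInf_AE) auto
  have "AE x in \<rho>. ennreal (b x * b x) \<le> ennreal (\<omega>'\<^sup>2) * inverse (ennreal (w x))"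
    using AE1 AE2 AE_space
  proof eventually_elim
    case (elim x)
    then have wpos: "w x > 0"
      using w0[of x] by (cases "w x = 0") auto
    have "ennreal (sqrt (w x) * \<bar>b x\<bar>) \<le> ennreal \<omega>'" using elim(1) bd' by (rule order_trans)
    then have "sqrt (w x) * \<bar>b x\<bar> \<le> \<omega>'" by (subst (asm) ennreal_le_iff) (simp add: \<omega>'_def)
    then have "(sqrt (w x) * \<bar>b x\<bar>)\<^sup>2 \<le> \<omega>'\<^sup>2" using wpos by (intro power_mono) auto
    then have "w x * (b x)\<^sup>2 \<le> \<omega>'\<^sup>2" using wpos by (simp add: power_mult_distrib)
    then have "b x * b x \<le> \<omega>'\<^sup>2 * inverse (w x)"
      using wpos by (simp add: field_simps power2_eq_square)
    then show ?case using wpos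
      by (simp add: inverse_ennreal flip: ennreal_mult)
  qed
  then have "(\<integral>\<^sup>+x. ennreal (b x * b x) \<partial>\<rho>)
      \<le> (\<integral>\<^sup>+x. ennreal (\<omega>'\<^sup>2) * inverse (ennreal (w x)) \<partial>\<rho>)"
    by (rule nn_integral_mono_AE)
  also have "\<dots> = ennreal (\<omega>'\<^sup>2)" using winv by (subst nn_integral_cmult) auto
  finally have le: "(\<integral>\<^sup>+x. ennreal (b x * b x) \<partial>\<rho>) \<le> ennreal (\<omega>'\<^sup>2)" .
  \<comment> \<open>the integral of a function that is not integrable is zero\<close>
  have "integrable \<rho> (\<lambda>x. b x * b x)"
    using b1 not_integrable_integral_eq by fastforce
  then have "(\<integral>\<^sup>+x. ennreal (b x * b x) \<partial>\<rho>) = ennreal 1"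
    using b1 by (subst nn_integral_eq_integral) auto
  with le have "1 \<le> \<omega>'\<^sup>2" by simp
  then have "1 \<le> \<omega>'" by (intro power2_le_imp_le[of 1]) (simp_all add: \<omega>'_def)
  then show ?thesis by (simp add: \<omega>'_def max_def split: if_splits)
qed

section \<open>Transfer of the restricted isometry property\<close>

text \<open>
  In this form the empirical norm inherits homogeneity and the triangle inequality from the
  Euclidean norm.
\<close>

lemma empirical_nrm_eq_L2_set:
  assumes "\<forall>i\<in>{1..n}. w (y i) \<ge> 0"
  shows "empirical_nrm w n y f = L2_set (\<lambda>i. sqrt (w (y i) / n) * f (y i)) {1..n}"
  using assms unfolding empirical_nrm_def L2_set_def
  by (simp add: sum_distrib_left power_mult_distrib)

lemma L2_set_diff_ineq: "\<bar>L2_set f A - L2_set g A\<bar> \<le> L2_set (\<lambda>i. f i - g i) A"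
proof -
  have "L2_set f A \<le> L2_set (\<lambda>i. f i - g i) A + L2_set g A"
    using L2_set_triangle_ineq[of "\<lambda>i. f i - g i" g A] by simp
  moreover have "L2_set g A \<le> L2_set (\<lambda>i. f i - g i) A + L2_set f A"
    using L2_set_triangle_ineq[of "\<lambda>i. g i - f i" f A]
    by (simp add: L2_set_def power2_commute)
  ultimately show ?thesis by linarith
qed

text \<open>
  \<open>T\<close> and \<open>U\<close> stand for the true and empirical norms of the rescaled function, \<open>1\<close> and \<open>N\<close> for
  those of the normalised function nearby. To first order in \<open>\<epsilon>\<close> and \<open>\<delta>\<close>, the ratio
  \<open>U\<^sup>2 / T\<^sup>2\<close> deviates from \<open>N\<^sup>2\<close> by at most \<open>4\<epsilon>\<close>, and \<open>\<epsilon> \<le> \<delta> / 15\<close> leaves enough room for the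
  higher-order terms.
\<close>

lemma perturbed_isometry_bounds:
  fixes \<delta> \<epsilon> T U N :: real
  assumes \<delta>: "0 < \<delta>" "\<delta> \<le> 1/2" and \<epsilon>: "\<epsilon> \<le> \<delta> / 15"
    and T: "\<bar>T - 1\<bar> \<le> \<epsilon>" and U: "\<bar>U - N\<bar> \<le> \<epsilon>" and "N \<ge> 0" "U \<ge> 0"
    and N: "1 - \<delta> \<le> N\<^sup>2" "N\<^sup>2 \<le> 1 + \<delta>"
  shows "(1 - 2 * \<delta>) * T\<^sup>2 \<le> U\<^sup>2" "U\<^sup>2 \<le> (1 + 2 * \<delta>) * T\<^sup>2"
proof -
  \<comment> \<open>expressing everything in the single small parameter \<open>e\<close> reduces the claims to polynomial inequalities in \<open>e\<close>\<close>
  define e where "e = \<delta> / 15"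
  have e: "0 < e" "e \<le> 1/30" "\<delta> = 15 * e" using \<delta> by (auto simp: e_def)
  have T': "1 - e \<le> T" "T \<le> 1 + e" and U': "N - e \<le> U" "U \<le> N + e"
    using T U \<epsilon> by (auto simp: e_def)
  have N2: "N \<le> 1 + \<delta> / 2"
  proof (rule power2_le_imp_le)
    have "(1 + \<delta> / 2)\<^sup>2 = 1 + \<delta> + (\<delta> / 2)\<^sup>2" by (simp add: power2_eq_square algebra_simps)
    then show "N\<^sup>2 \<le> (1 + \<delta> / 2)\<^sup>2" using N(2) zero_le_power2[of "\<delta> / 2"] by linarith
  qed (use \<delta> in simp)
  have sq_e: "e\<^sup>2 \<le> e * (1/30)" unfolding power2_eq_square using e by (intro mult_left_mono) auto
  have "U\<^sup>2 \<le> (1 + \<delta> / 2 + e)\<^sup>2" using U' N2 \<open>U \<ge> 0\<close> by (intro power_mono) auto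
  also have "\<dots> = 1 + 17 * e + 289/4 * e\<^sup>2"
    unfolding e(3) by (simp add: power2_eq_square algebra_simps)
  also have "\<dots> \<le> 1 + 28 * e - 60 * e\<^sup>2" using sq_e e by linarith
  also have "\<dots> \<le> (1 + 2 * \<delta>) * (1 - 2 * e)"
    unfolding e(3) by (simp add: power2_eq_square algebra_simps)
  also have "\<dots> \<le> (1 + 2 * \<delta>) * (1 - e)\<^sup>2"
    using \<delta> by (intro mult_left_mono) (auto simp: power2_diff)
  also have "\<dots> \<le> (1 + 2 * \<delta>) * T\<^sup>2"
    using \<delta> e T' by (intro mult_left_mono power_mono) auto
  finally show "U\<^sup>2 \<le> (1 + 2 * \<delta>) * T\<^sup>2" .
  have "N\<^sup>2 \<ge> (1/2)\<^sup>2" using N(1) \<delta> by (simp add: power2_eq_square)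
  then have "N \<ge> 1/2" using \<open>N \<ge> 0\<close> by (rule power2_le_imp_le)
  have "(1 - 2 * \<delta>) * T\<^sup>2 \<le> (1 - 2 * \<delta>) * (1 + e)\<^sup>2"
    using \<delta> e T' by (intro mult_left_mono power_mono) auto
  also have "\<dots> = (1 - 30 * e) * (1 + 2 * e + e\<^sup>2)"
    unfolding e(3) by (simp add: power2_eq_square algebra_simps)
  also have "\<dots> \<le> (1 - 30 * e) * (1 + 3 * e)"
    using e sq_e by (intro mult_left_mono) auto
  also have "\<dots> \<le> 1 - 27 * e" using e by (simp add: algebra_simps)
  also have "\<dots> \<le> 1 - \<delta> - 2 * e * (1 + \<delta> / 2)" using sq_e e by (simp add: power2_eq_square algebra_simps)
  also have "\<dots> \<le> N\<^sup>2 - 2 * e * N"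
    using N(1) N2 e by (smt (verit) mult_left_mono)
  also have "\<dots> \<le> (N - e)\<^sup>2" by (simp add: power2_diff)
  also have "\<dots> \<le> U\<^sup>2" using U' \<open>N \<ge> 1/2\<close> e by (intro power_mono) auto
  finally show "(1 - 2 * \<delta>) * T\<^sup>2 \<le> U\<^sup>2" .
qed

section \<open>Distance and restricted isometry of the model class\<close>

theorem theorem55:
  fixes \<rho> :: "'y measure"
    and w :: "'y \<Rightarrow> real"
    and m :: nat
    and d :: "nat \<Rightarrow> nat"
    and B :: "(nat \<Rightarrow> nat) \<Rightarrow> 'y \<Rightarrow> real"
    and \<omega> :: "(nat \<Rightarrow> nat) \<Rightarrow> real"
    and R :: nat
    and c r r' :: real
  defines "J \<equiv> tensor_index m d"
  assumes "prob_space \<rho>"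
    and "m \<ge> 1"
    and "orthonormal_family \<rho> J B"
    and "w \<in> borel_measurable \<rho>"
    and "\<And>x. x \<in> space \<rho> \<Longrightarrow> w x \<ge> 0"
    and "(\<integral>\<^sup>+ x. inverse (ennreal (w x)) \<partial>\<rho>) = 1"
    and "\<And>j. j \<in> J \<Longrightarrow> Linf_w \<rho> w (B j) \<le> ennreal (\<omega> j)"
    and "c > 0" and "r > 0"
    and "r' = (1 + c\<^sup>2) * (lp_norm J (2/3) (\<lambda>j. inverse (\<omega> j)))\<^sup>2 * r"
  shows "dist_si_Linf_w \<rho> w
           (tensor_fun J B ` model_class m d R r \<omega>)
           (tensor_fun J B ` l0_ball J \<omega> r') \<le> ennreal (1 / c)
    \<and> (\<forall>\<delta> n y. 0 < \<delta> \<longrightarrow> \<delta> \<le> 1/2 \<longrightarrow> c \<ge> 15 / \<delta> \<longrightarrow> n \<ge> 1 \<longrightarrow>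
         (\<forall>i\<in>{1..n}. y i \<in> space \<rho>) \<longrightarrow>
         (\<forall>v\<in>tensors J. \<forall>i\<in>{1..n}.
            ennreal (sqrt (w (y i)) * \<bar>tensor_fun J B v (y i)\<bar>)
              \<le> Linf_w \<rho> w (tensor_fun J B v)) \<longrightarrow>
         RIP \<rho> w n y (tensor_fun J B ` l0_ball J \<omega> r') \<delta> \<longrightarrow>
         RIP \<rho> w n y (tensor_fun J B ` model_class m d R r \<omega>) (2 * \<delta>))"
proof -
  have finJ: "finite J" by (auto simp: J_def tensor_index_def intro!: finite_PiE)
  note on = \<open>orthonormal_family \<rho> J B\<close>
  have Bm: "B j \<in> borel_measurable \<rho>" if "j \<in> J" for j
    using on that by (simp add: orthonormal_family_def)
  have w0: "w x \<ge> 0" if "x \<in> space \<rho>" for x using assms(6) that .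
  have bd: "Linf_w \<rho> w (B j) \<le> ennreal (\<omega> j)" if "j \<in> J" for j using assms(8) that .
  have \<omega>1: "\<omega> j \<ge> 1" if "j \<in> J" for j
    using on that assms(5,7) w0 bd[OF that]
    by (intro one_le_weight[of "B j" \<rho> w]) (auto simp: orthonormal_family_def)
  note L2 = L2_nrm_tensor_fun[OF finJ on]
  have diff: "(\<lambda>x. t * tensor_fun J B v x - tensor_fun J B b x)
      = tensor_fun J B (\<lambda>j. t * v j - b j)" for t v b
    by (simp add: tensor_fun_def fun_eq_iff sum_distrib_left sum_subtractf algebra_simps)
  have approx: "\<exists>t b. t > 0 \<and> b \<in> l0_ball J \<omega> r' \<and> L2_set b J = 1 \<and>
      (\<Sum>j\<in>J. \<omega> j * \<bar>t * v j - b j\<bar>) \<le> 1 / c"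
    if v: "v \<in> model_class m d R r \<omega>" and nz: "\<exists>j\<in>J. v j \<noteq> 0" for v
  proof -
    have energy: "(\<Sum>j\<in>J. (\<omega> j ^ 3 * v j)\<^sup>2) \<le> r * (\<Sum>j\<in>J. (v j)\<^sup>2)"
      unfolding J_def by (rule model_class_energy(2)[OF v \<open>m \<ge> 1\<close>])
    obtain t b where "t > 0" "b \<in> l0_ball J \<omega> r'" "L2_set b J = 1"
      "(\<Sum>j\<in>J. \<omega> j * \<bar>t * v j - b j\<bar>) \<le> 1 / c"
      unfolding assms(11)
      by (rule near_normalised_sparse[OF finJ \<omega>1 nz energy \<open>c > 0\<close> \<open>r > 0\<close>])
    then show ?thesis by blast
  qed
  have Linf: "Linf_w \<rho> w (tensor_fun J B u) \<le> ennreal (1 / c)"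
    if "(\<Sum>j\<in>J. \<omega> j * \<bar>u j\<bar>) \<le> 1 / c" for u
  proof -
    have "Linf_w \<rho> w (tensor_fun J B u) \<le> ennreal (\<Sum>j\<in>J. \<omega> j * \<bar>u j\<bar>)"
      using \<omega>1 by (intro Linf_w_tensor_fun_le finJ Bm assms(5) w0 bd) force+
    also have "\<dots> \<le> ennreal (1 / c)" using that by (rule ennreal_leI)
    finally show ?thesis .
  qed
  have part1: "dist_si_Linf_w \<rho> w (tensor_fun J B ` model_class m d R r \<omega>)
      (tensor_fun J B ` l0_ball J \<omega> r') \<le> ennreal (1 / c)"
    unfolding dist_si_Linf_w_def
  proof (rule SUP_least)
    fix a assume "a \<in> nonzero_in \<rho> (tensor_fun J B ` model_class m d R r \<omega>)"
    then obtain v where v: "v \<in> model_class m d R r \<omega>" and a: "a = tensor_fun J B v"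
      and nz: "\<not> (AE x in \<rho>. a x = 0)" by (auto simp: nonzero_in_def)
    have "\<exists>j\<in>J. v j \<noteq> 0" using nz by (rule contrapos_np) (simp add: a tensor_fun_def)
    then obtain t b where t: "t > 0" and b: "b \<in> l0_ball J \<omega> r'" "L2_set b J = 1"
      and err: "(\<Sum>j\<in>J. \<omega> j * \<bar>t * v j - b j\<bar>) \<le> 1 / c" using approx[OF v] by blast
    have "\<not> (AE x in \<rho>. tensor_fun J B b x = 0)"
    proof
      assume "AE x in \<rho>. tensor_fun J B b x = 0"
      then have "(\<integral>x. (tensor_fun J B b x)\<^sup>2 \<partial>\<rho>) = 0"
        by (intro integral_eq_zero_AE) auto
      then show False using L2[of b] b(2) by (simp add: L2_nrm_def)
    qed
    then have "tensor_fun J B b \<in> nonzero_in \<rho> (tensor_fun J B ` l0_ball J \<omega> r')"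
      using b by (auto simp: nonzero_in_def)
    then have "tensor_fun J B b \<in> normalised \<rho> (tensor_fun J B ` l0_ball J \<omega> r')"
      unfolding normalised_def
      by (rule rev_image_eqI) (simp add: L2 b(2))
    then have "(t, tensor_fun J B b)
        \<in> {0<..} \<times> normalised \<rho> (tensor_fun J B ` l0_ball J \<omega> r')" using t by simp
    then show "(INF (t, b)\<in>{0<..} \<times> normalised \<rho> (tensor_fun J B ` l0_ball J \<omega> r').
        Linf_w \<rho> w (\<lambda>x. t * a x - b x)) \<le> ennreal (1 / c)"
      by (rule INF_lower2) (use Linf[OF err] in \<open>simp add: a diff\<close>)
  qed
  moreover have "RIP \<rho> w n y (tensor_fun J B ` model_class m d R r \<omega>) (2 * \<delta>)"
    if \<delta>: "0 < \<delta>" "\<delta> \<le> 1/2" "c \<ge> 15 / \<delta>" and n: "n \<ge> 1"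
      and y: "\<forall>i\<in>{1..n}. y i \<in> space \<rho>"
      and pt: "\<forall>v\<in>tensors J. \<forall>i\<in>{1..n}.
            ennreal (sqrt (w (y i)) * \<bar>tensor_fun J B v (y i)\<bar>) \<le> Linf_w \<rho> w (tensor_fun J B v)"
      and rip: "RIP \<rho> w n y (tensor_fun J B ` l0_ball J \<omega> r') \<delta>"
    for \<delta> n y
    unfolding RIP_def
  proof (rule ballI)
    fix u assume "u \<in> tensor_fun J B ` model_class m d R r \<omega>"
    then obtain v where v: "v \<in> model_class m d R r \<omega>" and u: "u = tensor_fun J B v" by auto
    have wy: "\<forall>i\<in>{1..n}. w (y i) \<ge> 0" using y w0 by blast
    note emp = empirical_nrm_eq_L2_set[where w = w and y = y and n = n, OF wy]
    show "(1 - 2 * \<delta>) * (L2_nrm \<rho> u)\<^sup>2 \<le> (empirical_nrm w n y u)\<^sup>2 \<and>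
          (empirical_nrm w n y u)\<^sup>2 \<le> (1 + 2 * \<delta>) * (L2_nrm \<rho> u)\<^sup>2"
    proof (cases "\<exists>j\<in>J. v j \<noteq> 0")
      case False
      then have "u = (\<lambda>x. 0)" by (simp add: u tensor_fun_def)
      then show ?thesis by (simp add: L2_nrm_def empirical_nrm_def)
    next
      case True
      then obtain t b where t: "t > 0" and b: "b \<in> l0_ball J \<omega> r'" "L2_set b J = 1"
        and err: "(\<Sum>j\<in>J. \<omega> j * \<bar>t * v j - b j\<bar>) \<le> 1 / c" using approx[OF v] by blast
      \<comment> \<open>the error is itself a finite expansion, so the pointwise bound applies to it\<close>
      define e where "e = (\<lambda>j. t * v j - b j)"
      have eT: "e \<in> tensors J"
        using b model_class_energy(1)[OF v \<open>m \<ge> 1\<close>]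
        by (simp add: e_def l0_ball_def tensors_def J_def)
      have "1 / c > 0" using \<open>c > 0\<close> by simp
      define T where "T = L2_set (\<lambda>j. t * v j) J"
      have TL: "T = t * L2_nrm \<rho> u" using t by (simp add: T_def u L2 L2_set_right_distrib)
      have "L2_set e J \<le> (\<Sum>j\<in>J. \<omega> j * \<bar>e j\<bar>)"
        using \<omega>1 by (rule L2_set_le_weighted_l1)
      also have "\<dots> \<le> 1 / c" using err by (simp add: e_def)
      finally have eL: "L2_set e J \<le> 1 / c" .
      have T1: "\<bar>T - 1\<bar> \<le> 1 / c"
        using L2_set_diff_ineq[of "\<lambda>j. t * v j" J b] eL b(2) by (simp add: T_def e_def)
      define U where "U = empirical_nrm w n y (\<lambda>x. t * u x)"
      define N where "N = empirical_nrm w n y (tensor_fun J B b)"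
      have UL: "U = t * empirical_nrm w n y u"
        using t by (simp add: U_def emp L2_set_right_distrib mult_ac)
      have "\<bar>U - N\<bar> \<le> empirical_nrm w n y (tensor_fun J B e)"
        using L2_set_diff_ineq[of "\<lambda>i. sqrt (w (y i) / n) * (t * u (y i))" "{1..n}"
            "\<lambda>i. sqrt (w (y i) / n) * tensor_fun J B b (y i)"]
        unfolding U_def N_def emp e_def diff[symmetric] by (simp add: u right_diff_distrib)
      also have "\<dots> \<le> 1 / c"
      proof -
        have "w (y i) * \<bar>tensor_fun J B e (y i)\<bar>\<^sup>2 \<le> (1 / c)\<^sup>2" if i: "i \<in> {1..n}" for i
        proof -
          have "ennreal (sqrt (w (y i)) * \<bar>tensor_fun J B e (y i)\<bar>) \<le> ennreal (1 / c)"
            using pt eT i Linf[of e] err unfolding e_def by (meson order_trans)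
          then have "sqrt (w (y i)) * \<bar>tensor_fun J B e (y i)\<bar> \<le> 1 / c"
            using \<open>1 / c > 0\<close> by simp
          then have "(sqrt (w (y i)) * \<bar>tensor_fun J B e (y i)\<bar>)\<^sup>2 \<le> (1 / c)\<^sup>2"
            using wy i by (intro power_mono) auto
          then show ?thesis using wy i by (simp add: power_mult_distrib)
        qed
        then have "(\<Sum>i\<in>{1..n}. w (y i) * \<bar>tensor_fun J B e (y i)\<bar>\<^sup>2) \<le> (\<Sum>i\<in>{1..n}. (1 / c)\<^sup>2)"
          by (rule sum_mono)
        then have "1 / real n * (\<Sum>i\<in>{1..n}. w (y i) * \<bar>tensor_fun J B e (y i)\<bar>\<^sup>2) \<le> (1 / c)\<^sup>2"
          using n by (simp add: field_simps)
        then show ?thesis unfolding empirical_nrm_def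
          using \<open>1 / c > 0\<close> by (intro real_le_lsqrt) auto
      qed
      finally have UN: "\<bar>U - N\<bar> \<le> 1 / c" .
      have "1 / c \<le> \<delta> / 15" using \<delta> \<open>c > 0\<close> by (simp add: field_simps)
      moreover have "1 - \<delta> \<le> N\<^sup>2" "N\<^sup>2 \<le> 1 + \<delta>"
        using rip b by (auto simp: RIP_def N_def L2)
      moreover have "N \<ge> 0" "U \<ge> 0" by (simp_all add: N_def U_def emp)
      ultimately have "(1 - 2 * \<delta>) * T\<^sup>2 \<le> U\<^sup>2" "U\<^sup>2 \<le> (1 + 2 * \<delta>) * T\<^sup>2"
        using perturbed_isometry_bounds[OF \<delta>(1,2) _ T1 UN] by blast+
      then have "t\<^sup>2 * ((1 - 2 * \<delta>) * (L2_nrm \<rho> u)\<^sup>2) \<le> t\<^sup>2 * (empirical_nrm w n y u)\<^sup>2"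
        "t\<^sup>2 * (empirical_nrm w n y u)\<^sup>2 \<le> t\<^sup>2 * ((1 + 2 * \<delta>) * (L2_nrm \<rho> u)\<^sup>2)"
        by (simp_all add: TL UL power_mult_distrib mult_ac)
      then show ?thesis using t by simp
    qed
  qed
  ultimately show ?thesis by blast
qed

end
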